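(* Let $H$ be a maximal plane graph which does not have a dominating face (i.e., for no face $f$ of $H$ is every vertex of $H$ on the boundary of $f$ or adjacent to a vertex on the boundary of $f$). If $G$ is a plane graph containing $H$ as a plane subgraph such that $H$ is equi-eccentric in $G$, then $H$ is a subgraph of the center of $G$.
   Context: A maximal plane graph is a plane embedding of a maximal planar graph. The eccentricity of $u$ in a connected graph $G$ is $e_G(u)=\max_{x\in V(G)} d_G(u,x)$; the center of $G$ is the subgraph induced by the vertices of minimum eccentricity. A subgraph $H$ of $G$ is equi-eccentric in $G$ if all vertices of $H$ have the same eccentricity in $G$. *)

theory Defs
  imports "Graph_Theory.Shortest_Path" "Graph_Theory.Digraph_Component" "HOL-Analysis.Analysis"
begin

text \<open>
  Finite simple graphs are the symmetric loop-free digraphs of \<open>pair_graph\<close>: an edge \<open>uv\<close> is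
  represented by the two arcs \<open>(u,v)\<close> and \<open>(v,u)\<close>.
\<close>

subsection \<open>Distance, eccentricity, center\<close>

definition graph_dist :: "'a pair_pre_digraph \<Rightarrow> 'a \<Rightarrow> 'a \<Rightarrow> ereal" where
  "graph_dist G u v = wf_digraph.\<mu> (with_proj G) (\<lambda>_. 1) u v"

definition eccentricity :: "'a pair_pre_digraph \<Rightarrow> 'a \<Rightarrow> ereal" where
  "eccentricity G u = Max (graph_dist G u ` pverts G)"

definition graph_center :: "'a pair_pre_digraph \<Rightarrow> ('a, 'a \<times> 'a) pre_digraph" where
  "graph_center G =
     with_proj G \<restriction> {u \<in> pverts G. \<forall>v\<in>pverts G. eccentricity G u \<le> eccentricity G v}"

definition equi_eccentric :: "'a pair_pre_digraph \<Rightarrow> 'a pair_pre_digraph \<Rightarrow> bool" where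
  "equi_eccentric H G \<longleftrightarrow> subgraph (with_proj H) (with_proj G) \<and>
     (\<forall>u\<in>pverts H. \<forall>v\<in>pverts H. eccentricity G u = eccentricity G v)"

subsection \<open>Plane graphs\<close>

text \<open>
  The plane is \<^typ>\<open>complex\<close>. A vertex is placed at a point; the curve of an edge is the point set
  of the (closed) arc representing it, and is the same for both orientations of the edge.
\<close>

record 'a plane_drawing =
  ugraph :: "'a pair_pre_digraph"
  point :: "'a \<Rightarrow> complex"
  curve :: "'a \<times> 'a \<Rightarrow> complex set"

definition plane_graph :: "'a plane_drawing \<Rightarrow> bool" where
  "plane_graph D \<longleftrightarrow>
     pair_graph (ugraph D) \<and>
     inj_on (point D) (pverts (ugraph D)) \<and>
     (\<forall>(u,v)\<in>parcs (ugraph D).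
        (\<exists>g. arc g \<and> pathstart g = point D u \<and> pathfinish g = point D v \<and>
             path_image g = curve D (u,v)) \<and>
        curve D (v,u) = curve D (u,v) \<and>
        (\<forall>w\<in>pverts (ugraph D). point D w \<in> curve D (u,v) \<longrightarrow> w = u \<or> w = v)) \<and>
     (\<forall>(u,v)\<in>parcs (ugraph D). \<forall>(x,y)\<in>parcs (ugraph D). {u,v} \<noteq> {x,y} \<longrightarrow>
        curve D (u,v) \<inter> curve D (x,y) \<subseteq> point D ` ({u,v} \<inter> {x,y}))"

definition plane_subgraph :: "'a plane_drawing \<Rightarrow> 'a plane_drawing \<Rightarrow> bool" where
  "plane_subgraph H G \<longleftrightarrow>
     subgraph (with_proj (ugraph H)) (with_proj (ugraph G)) \<and>
     (\<forall>v\<in>pverts (ugraph H). point H v = point G v) \<and>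
     (\<forall>e\<in>parcs (ugraph H). curve H e = curve G e)"

definition planar :: "'a pair_pre_digraph \<Rightarrow> bool" where
  "planar G \<longleftrightarrow> (\<exists>D. plane_graph D \<and> ugraph D = G)"

definition add_edge :: "'a pair_pre_digraph \<Rightarrow> 'a \<Rightarrow> 'a \<Rightarrow> 'a pair_pre_digraph" where
  "add_edge G u v = \<lparr> pverts = pverts G, parcs = {(u,v), (v,u)} \<union> parcs G \<rparr>"

definition maximal_planar :: "'a pair_pre_digraph \<Rightarrow> bool" where
  "maximal_planar G \<longleftrightarrow> planar G \<and>
     (\<forall>u\<in>pverts G. \<forall>v\<in>pverts G. u \<noteq> v \<and> (u,v) \<notin> parcs G \<longrightarrow> \<not> planar (add_edge G u v))"

definition maximal_plane_graph :: "'a plane_drawing \<Rightarrow> bool" where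
  "maximal_plane_graph D \<longleftrightarrow> plane_graph D \<and> maximal_planar (ugraph D)"

definition plane_support :: "'a plane_drawing \<Rightarrow> complex set" where
  "plane_support D = point D ` pverts (ugraph D) \<union> (\<Union>e\<in>parcs (ugraph D). curve D e)"

definition faces :: "'a plane_drawing \<Rightarrow> complex set set" where
  "faces D = components (- plane_support D)"

definition boundary_verts :: "'a plane_drawing \<Rightarrow> complex set \<Rightarrow> 'a set" where
  "boundary_verts D f = {v \<in> pverts (ugraph D). point D v \<in> frontier f}"

definition dominating_face :: "'a plane_drawing \<Rightarrow> complex set \<Rightarrow> bool" where
  "dominating_face D f \<longleftrightarrow> f \<in> faces D \<and>
     (\<forall>v\<in>pverts (ugraph D).
        v \<in> boundary_verts D f \<or> (\<exists>w\<in>boundary_verts D f. (v,w) \<in> parcs (ugraph D)))"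

end

theory Submission
  imports Defs
begin

text \<open>
  Suppose a vertex \<open>v\<close> of \<open>G\<close> has eccentricity smaller than the common eccentricity \<open>r\<close> of \<open>H\<close>.
  Then \<open>v\<close> lies in a face \<open>f\<close> of \<open>H\<close>. Let \<open>F\<close> be the set of vertices of \<open>G\<close> in \<open>f\<close> and \<open>B\<close> the set of
  vertices of \<open>H\<close> that are adjacent in \<open>G\<close> to \<open>F\<close>. Every walk that leaves \<open>F\<close> meets \<open>B\<close>, the set \<open>B\<close> is
  contained in the boundary of \<open>f\<close>, and \<open>B\<close> is a clique: two of its members are joined by an arc
  through \<open>f\<close>, so they are adjacent by maximality of \<open>H\<close>. For \<open>b \<in> B\<close> let \<open>x\<close> be at distance \<open>r\<close> from
  \<open>b\<close>. If \<open>x \<notin> F\<close>, a shortest walk from \<open>v\<close> to \<open>x\<close> leaves \<open>F\<close> through some \<open>b' \<in> B\<close>, at distance at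
  most \<open>r - 2\<close> from \<open>x\<close>, so \<open>x\<close> is too close to \<open>b\<close>. Hence \<open>x \<in> F\<close>. As \<open>f\<close> is not dominating, some
  \<open>w\<close> in \<open>H\<close> has distance at least 2 from \<open>B\<close>; since \<open>B\<close> separates \<open>w\<close> from \<open>x\<close> and each member of
  \<open>B\<close> has distance at least \<open>r - 1\<close> from \<open>x\<close>, the distance from \<open>w\<close> to \<open>x\<close> exceeds \<open>r\<close>.
  Working with \<open>B\<close> rather than with all vertices on the boundary of \<open>f\<close> makes accessibility of
  boundary points trivial.
\<close>

section \<open>Walks and distances\<close>

text \<open>Cut the walk at its first vertex outside \<open>F\<close>. At least one step leads there
  because the walk starts in \<open>F\<close>; the \<open>Suc\<close> in the length records this and
  supplies the strict bounds later.\<close>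

lemma relpow_leaving_set:
  assumes "\<And>y z. y \<in> F \<Longrightarrow> (y, z) \<in> E \<Longrightarrow> z \<in> F \<or> z \<in> B"
    and "(y, z) \<in> E ^^ n" "y \<in> F" "z \<notin> F"
  obtains b i j where "b \<in> B" "(y, b) \<in> E ^^ Suc i" "(b, z) \<in> E ^^ j" "n = Suc i + j"
proof -
  have "\<exists>b\<in>B. \<exists>i j. (y, b) \<in> E ^^ Suc i \<and> (b, z) \<in> E ^^ j \<and> n = Suc i + j"
    using assms(2,3)
  proof (induction n arbitrary: y)
    case 0
    then show ?case using assms(4) by simp
  next
    case (Suc n)
    from Suc.prems(1) obtain u where u: "(y, u) \<in> E" "(u, z) \<in> E ^^ n"
      by (rule relpow_Suc_E2)
    show ?case
    proof (cases "u \<in> F")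
      case True
      then obtain b i j where *: "b \<in> B" "(u, b) \<in> E ^^ Suc i" "(b, z) \<in> E ^^ j" "n = Suc i + j"
        using Suc.IH u(2) by blast
      have "(y, b) \<in> E ^^ Suc (Suc i)"
        using u(1) *(2) by (rule relpow_Suc_I2)
      with * show ?thesis by (intro bexI[of _ b] exI[of _ "Suc i"] exI[of _ j]) auto
    next
      case False
      then have "u \<in> B" using assms(1) Suc.prems(2) u(1) by blast
      with u show ?thesis by (intro bexI[of _ u] exI[of _ 0] exI[of _ n]) auto
    qed
  qed
  with that show thesis by blast
qed

lemma relpow_sym:
  assumes "sym E" "(x, y) \<in> E ^^ n"
  shows "(y, x) \<in> E ^^ n"
  using assms(2)
proof (induction n arbitrary: y)
  case (Suc n)
  from Suc.prems obtain z where "(x, z) \<in> E ^^ n" "(z, y) \<in> E"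
    by (rule relpow_Suc_E)
  with Suc.IH show ?case using assms(1) by (meson relpow_Suc_I2 symD)
qed simp

text \<open>The combinatorial half of the argument, free of topology. Bounds on eccentricities by
  \<open>r\<close> are phrased through walk lengths: that of \<open>v\<close> is below
  \<open>r\<close>, those of \<open>B\<close> are at least \<open>r\<close>, that of
  \<open>w\<close> is at most \<open>r\<close>.\<close>

lemma clique_separator_eccentricity:
  assumes "sym E"
    and leave: "\<And>y z. y \<in> F \<Longrightarrow> (y, z) \<in> E \<Longrightarrow> z \<in> F \<or> z \<in> B"
    and clique: "\<And>b c. b \<in> B \<Longrightarrow> c \<in> B \<Longrightarrow> b = c \<or> (b, c) \<in> E"
    and w: "w \<in> V" "w \<notin> F" "w \<notin> B" "\<And>b. b \<in> B \<Longrightarrow> (w, b) \<notin> E"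
    and v: "v \<in> F"
    and v_near: "\<And>x. x \<in> V \<Longrightarrow> \<exists>m<r. (v, x) \<in> E ^^ m"
    and B_far: "\<And>b. b \<in> B \<Longrightarrow> \<exists>x\<in>V. \<forall>m. (b, x) \<in> E ^^ m \<longrightarrow> r \<le> m"
    and w_near: "\<And>x. x \<in> V \<Longrightarrow> \<exists>m\<le>r. (w, x) \<in> E ^^ m"
  shows False
proof -
  obtain m where "(v, w) \<in> E ^^ m" using v_near[OF w(1)] by blast
  \<comment> \<open>\<open>B\<close> is nonempty because a walk from \<open>v\<close> to
    \<open>w\<close> has to leave \<open>F\<close>.\<close>
  from leave this v w(2) obtain b where b: "b \<in> B" by (rule relpow_leaving_set)
  then obtain x where x: "x \<in> V" and far: "\<And>m. (b, x) \<in> E ^^ m \<Longrightarrow> r \<le> m"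
    using B_far by blast
  \<comment> \<open>Moving from \<open>b\<close> to another member of the clique costs at most one
    step, so all of \<open>B\<close> is at distance at least r - 1 from \<open>x\<close>.\<close>
  have far': "r \<le> Suc m" if "c \<in> B" "(c, x) \<in> E ^^ m" for c m
    using clique[OF b that(1)]
  proof
    assume "b = c"
    with far that(2) show ?thesis by (simp add: le_SucI)
  next
    assume "(b, c) \<in> E"
    then show ?thesis using that(2) by (intro far relpow_Suc_I2)
  qed
  have "x \<in> F"
  proof (rule ccontr)
    assume "x \<notin> F"
    obtain m where m: "m < r" "(v, x) \<in> E ^^ m" using v_near[OF x] by blast
    \<comment> \<open>Here \<open>j\<close> is at most r - 2, since m < r and at least one step
      precedes \<open>c\<close>; this contradicts \<open>far'\<close>.\<close>
    obtain c i j where "c \<in> B" "(c, x) \<in> E ^^ j" "m = Suc i + j"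
      by (rule relpow_leaving_set[OF leave m(2) v \<open>x \<notin> F\<close>])
    with far' m(1) show False by fastforce
  qed
  obtain m where m: "m \<le> r" "(w, x) \<in> E ^^ m" using w_near[OF x] by blast
  \<comment> \<open>Reversed, the walk starts in \<open>F\<close>. It needs at least r - 1 steps to
    reach \<open>B\<close> and two more to reach \<open>w\<close>, which exceeds
    \<open>r\<close>.\<close>
  have "(x, w) \<in> E ^^ m" using assms(1) m(2) by (rule relpow_sym)
  from leave this \<open>x \<in> F\<close> w(2) obtain c i j where c: "c \<in> B" "(x, c) \<in> E ^^ Suc i" "(c, w) \<in> E ^^ j"
      and ij: "m = Suc i + j"
    by (rule relpow_leaving_set)
  have "r \<le> Suc (Suc i)"
    using far'[OF c(1) relpow_sym[OF assms(1) c(2)]] .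
  moreover have "j \<noteq> 0" using c w(3) by (intro notI) auto
  moreover have "j \<noteq> 1" using c(1,3) w(4) assms(1) by (auto dest: symD)
  ultimately show False using ij m(1) by linarith
qed

section \<open>Distances as least lengths of walks\<close>

lemma (in pair_wf_digraph) relpow_iff_awalk:
  assumes "u \<in> pverts G"
  shows "(u, v) \<in> parcs G ^^ n \<longleftrightarrow> (\<exists>p. awalk u p v \<and> length p = n)"
  using assms
proof (induction n arbitrary: u)
  case 0
  then show ?case by (auto simp: awalk_Nil_iff)
next
  case (Suc n)
  show ?case
  proof
    assume "(u, v) \<in> parcs G ^^ Suc n"
    then obtain z where z: "(u, z) \<in> parcs G" "(z, v) \<in> parcs G ^^ n"
      by (rule relpow_Suc_E2)
    with Suc.IH obtain p where "awalk z p v" "length p = n"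
      using in_arcsD2 by blast
    with z(1) show "\<exists>p. awalk u p v \<and> length p = Suc n"
      by (intro exI[of _ "(u, z) # p"]) (auto simp: awalk_Cons_iff)
  next
    assume "\<exists>p. awalk u p v \<and> length p = Suc n"
    then obtain e p where "awalk u (e # p) v" "length p = n"
      by (auto simp: length_Suc_conv)
    then have e: "(u, snd e) \<in> parcs G" "awalk (snd e) p v"
      by (auto simp: awalk_Cons_iff)
    then have "(snd e, v) \<in> parcs G ^^ n"
      using Suc.IH[OF in_arcsD2[OF e(1)]] \<open>length p = n\<close> by blast
    with e(1) show "(u, v) \<in> parcs G ^^ Suc n" by (rule relpow_Suc_I2)
  qed
qed

lemma (in wf_digraph) awalk_cost_one: "awalk_cost (\<lambda>_. 1) p = real (length p)"
  by (induction p) auto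

lemma graph_dist_le:
  assumes "pair_wf_digraph G" "u \<in> pverts G" "(u, v) \<in> parcs G ^^ n"
  shows "graph_dist G u v \<le> ereal (real n)"
proof -
  interpret pair_wf_digraph G by fact
  obtain p where "awalk u p v" "length p = n"
    using relpow_iff_awalk assms(2,3) by blast
  then show ?thesis
    unfolding graph_dist_def using min_cost_le_walk_cost[of u p v "\<lambda>_. 1"]
    by (simp add: awalk_cost_one)
qed

text \<open>The distance is an infimum in \<open>ereal\<close>. Reachability provides a walk, and
  the least walk length is both a lower bound for the infimum and one of the values.\<close>

lemma graph_dist_attained:
  assumes "pair_wf_digraph G" "u \<in> pverts G" "(u, v) \<in> (parcs G)\<^sup>*"
  obtains n where "graph_dist G u v = ereal (real n)" "(u, v) \<in> parcs G ^^ n"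
proof -
  interpret pair_wf_digraph G by fact
  define n where "n = (LEAST n. (u, v) \<in> parcs G ^^ n)"
  have n: "(u, v) \<in> parcs G ^^ n"
    unfolding n_def using assms(3) by (metis LeastI rtrancl_imp_relpow)
  have "ereal (real n) \<le> ereal (awalk_cost (\<lambda>_. 1) p)" if "awalk u p v" for p
  proof -
    have "(u, v) \<in> parcs G ^^ length p" using relpow_iff_awalk assms(2) that by blast
    then show ?thesis unfolding n_def by (simp add: awalk_cost_one Least_le)
  qed
  then have "ereal (real n) \<le> graph_dist G u v"
    unfolding graph_dist_def \<mu>_def by (intro INF_greatest) auto
  with graph_dist_le[OF assms(1,2) n] n that show thesis by (auto intro: antisym)
qed

section \<open>Plane drawings\<close>

lemma plane_graph_pair_graph: "plane_graph D \<Longrightarrow> pair_graph (ugraph D)"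
  by (simp add: plane_graph_def)

lemma pair_graph_sym:
  assumes "pair_graph G"
  shows "sym (parcs G)"
proof -
  interpret pair_graph G by fact
  show ?thesis using pair_sym_arcs by (simp add: symmetric_def)
qed

lemma pair_graph_verts:
  assumes "pair_graph G" "(u, v) \<in> parcs G"
  shows "u \<in> pverts G" "v \<in> pverts G" "u \<noteq> v"
proof -
  interpret pair_graph G by fact
  show "u \<in> pverts G" "v \<in> pverts G" using assms(2) by (auto dest: in_arcsD1 in_arcsD2)
  show "u \<noteq> v" using pair_no_loops[OF assms(2)] by simp
qed

lemma plane_graph_arc:
  assumes "plane_graph D" "(u, v) \<in> parcs (ugraph D)"
  obtains g where "arc g" "pathstart g = point D u" "pathfinish g = point D v"
    "path_image g = curve D (u, v)"
  using assms unfolding plane_graph_def by blast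

lemma plane_graph_curve_sym:
  assumes "plane_graph D" "(u, v) \<in> parcs (ugraph D)"
  shows "curve D (v, u) = curve D (u, v)"
  using assms unfolding plane_graph_def by blast

lemma plane_graph_vertex_on_curve:
  assumes "plane_graph D" "(u, v) \<in> parcs (ugraph D)" "w \<in> pverts (ugraph D)"
    "point D w \<in> curve D (u, v)"
  shows "w = u \<or> w = v"
  using assms unfolding plane_graph_def by blast

lemma plane_graph_curves_Int:
  assumes "plane_graph D" "(u, v) \<in> parcs (ugraph D)" "(x, y) \<in> parcs (ugraph D)"
    "{u, v} \<noteq> {x, y}"
  shows "curve D (u, v) \<inter> curve D (x, y) \<subseteq> point D ` ({u, v} \<inter> {x, y})"
  using assms unfolding plane_graph_def by blast

section \<open>Drawing an additional edge\<close>

lemma pair_graph_add_edge: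
  assumes "pair_graph G" "u \<in> pverts G" "v \<in> pverts G" "u \<noteq> v"
  shows "pair_graph (add_edge G u v)"
proof -
  interpret pair_graph G by fact
  show ?thesis
  proof unfold_locales
    show "symmetric (with_proj (add_edge G u v))"
      using pair_graph_sym[OF assms(1)] by (auto simp: symmetric_def add_edge_def sym_def)
  qed (use assms(2-) pair_finite_verts pair_finite_arcs pair_no_loops
        in \<open>auto simp: add_edge_def dest: in_arcsD1 in_arcsD2\<close>)
qed

lemma planar_add_edge:
  assumes "plane_graph D" "u \<in> pverts (ugraph D)" "v \<in> pverts (ugraph D)" "u \<noteq> v"
    and nadj: "(u, v) \<notin> parcs (ugraph D)"
    and g: "arc g" "pathstart g = point D u" "pathfinish g = point D v"
    and disj: "path_image g \<inter> plane_support D \<subseteq> {point D u, point D v}"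
  shows "planar (add_edge (ugraph D) u v)"
proof -
  define K where "K = add_edge (ugraph D) u v"
  define c where "c e = (if e = (u, v) \<or> e = (v, u) then path_image g else curve D e)" for e
  define D' where "D' = \<lparr> ugraph = K, point = point D, curve = c \<rparr>"
  note pg = plane_graph_pair_graph[OF assms(1)]
  have nadj': "(v, u) \<notin> parcs (ugraph D)"
    using nadj pair_graph_sym[OF pg] by (auto dest: symD)
  have K: "pverts K = pverts (ugraph D)" "parcs K = {(u, v), (v, u)} \<union> parcs (ugraph D)"
    by (simp_all add: K_def add_edge_def)
  have old: "c e = curve D e" if "e \<in> parcs (ugraph D)" for e
    using that nadj nadj' by (auto simp: c_def)
  have new: "c (u, v) = path_image g" "c (v, u) = path_image g"
    by (simp_all add: c_def)
  have inj: "inj_on (point D) (pverts (ugraph D))"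
    using assms(1) by (simp add: plane_graph_def)
  have new_vertex: "w = u \<or> w = v" if "w \<in> pverts (ugraph D)" "point D w \<in> path_image g" for w
  proof -
    have "point D w \<in> {point D u, point D v}"
      using disj that by (auto simp: plane_support_def)
    then show ?thesis using inj that(1) assms(2,3) by (auto dest: inj_onD)
  qed
  \<comment> \<open>\<open>disj\<close> only says that a common point is an end of \<open>g\<close>.
    That it is also an end of the old edge holds because a curve of \<open>D\<close> contains no
    vertices but its own ends.\<close>
  have new_old: "path_image g \<inter> curve D (x, y) \<subseteq> point D ` ({u, v} \<inter> {x, y})"
    if xy: "(x, y) \<in> parcs (ugraph D)" for x y
  proof
    fix p assume p: "p \<in> path_image g \<inter> curve D (x, y)"
    then have "p \<in> {point D u, point D v}"
      using disj xy by (auto simp: plane_support_def)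
    then obtain w where w: "w \<in> {u, v}" "p = point D w" by blast
    then have "w = x \<or> w = y"
      using p plane_graph_vertex_on_curve[OF assms(1) xy] assms(2,3) by blast
    with w show "p \<in> point D ` ({u, v} \<inter> {x, y})" by blast
  qed
  have "plane_graph D'"
    unfolding plane_graph_def
  proof (intro conjI)
    show "pair_graph (ugraph D')"
      using pair_graph_add_edge[OF pg assms(2-4)] by (simp add: D'_def K_def)
    show "inj_on (point D') (pverts (ugraph D'))"
      using inj by (simp add: D'_def K)
    show "\<forall>(x, y)\<in>parcs (ugraph D').
      (\<exists>g. arc g \<and> pathstart g = point D' x \<and> pathfinish g = point D' y \<and>
           path_image g = curve D' (x, y)) \<and>
      curve D' (y, x) = curve D' (x, y) \<and>
      (\<forall>w\<in>pverts (ugraph D'). point D' w \<in> curve D' (x, y) \<longrightarrow> w = x \<or> w = y)"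
    proof (clarify, goal_cases)
      case (1 x y)
      then consider "(x, y) \<in> parcs (ugraph D)" | "x = u" "y = v" | "x = v" "y = u"
        by (auto simp: D'_def K)
      then show ?case
      proof cases
        case 1
        then have "(y, x) \<in> parcs (ugraph D)" using pair_graph_sym[OF pg] by (auto dest: symD)
        with 1 show ?thesis
          using plane_graph_arc[OF assms(1) 1] plane_graph_curve_sym[OF assms(1) 1]
            plane_graph_vertex_on_curve[OF assms(1) 1]
          by (simp add: D'_def K old) metis
      next
        case 2
        then show ?thesis using g new_vertex by (auto simp: D'_def K new)
      next
        case 3
        then show ?thesis using g new_vertex arc_reversepath[OF g(1)]
          by (auto simp: D'_def K new intro!: exI[of _ "reversepath g"])
      qed
    qed
    show "\<forall>(a, b)\<in>parcs (ugraph D'). \<forall>(x, y)\<in>parcs (ugraph D'). {a, b} \<noteq> {x, y} \<longrightarrow>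
      curve D' (a, b) \<inter> curve D' (x, y) \<subseteq> point D' ` ({a, b} \<inter> {x, y})"
    proof (clarify, goal_cases)
      case (1 a b x y p)
      \<comment> \<open>Comparing \<open>{s, t}\<close> with \<open>{u, v}\<close> treats the two
        new arcs as one edge. Of the four resulting cases, two new arcs are excluded by
        \<open>{a, b} \<noteq> {x, y}\<close>.\<close>
      have split: "(s, t) \<in> parcs (ugraph D) \<and> c (s, t) = curve D (s, t) \<or>
          {s, t} = {u, v} \<and> c (s, t) = path_image g"
        if "(s, t) \<in> parcs (ugraph D')" for s t
        using that old new by (auto simp: D'_def K)
      have p: "p \<in> c (a, b)" "p \<in> c (x, y)" using 1 by (simp_all add: D'_def)
      have "p \<in> point D ` ({a, b} \<inter> {x, y})"
        using split[OF 1(1)] split[OF 1(2)]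
      proof (elim disjE conjE, goal_cases)
        case 1
        then show ?case
          using subsetD[OF plane_graph_curves_Int[OF assms(1) 1(1,3) \<open>{a, b} \<noteq> {x, y}\<close>], of p] p
          by simp
      next
        case 2
        then have "p \<in> point D ` ({u, v} \<inter> {a, b})"
          using subsetD[OF new_old[OF 2(1)], of p] p by simp
        then show ?case unfolding 2(3) by (subst Int_commute)
      next
        case 3
        then have "p \<in> point D ` ({u, v} \<inter> {x, y})"
          using subsetD[OF new_old[OF 3(3)], of p] p by simp
        then show ?case unfolding 3(1) .
      next
        case 4
        then show ?case using \<open>{a, b} \<noteq> {x, y}\<close> by simp
      qed
      then show ?case by (simp add: D'_def)
    qed
  qed
  then show ?thesis unfolding planar_def by (intro exI[of _ D']) (simp add: D'_def K_def)
qed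

text \<open>Maximality enters only in this form: an arc that meets the drawing at most in its ends
  could be added as an edge.\<close>

lemma maximal_plane_graph_adjacent:
  assumes "maximal_plane_graph D" "u \<in> pverts (ugraph D)" "v \<in> pverts (ugraph D)" "u \<noteq> v"
    and "arc g" "pathstart g = point D u" "pathfinish g = point D v"
    and "path_image g \<inter> plane_support D \<subseteq> {point D u, point D v}"
  shows "(u, v) \<in> parcs (ugraph D)"
proof (rule ccontr)
  assume nadj: "(u, v) \<notin> parcs (ugraph D)"
  have "plane_graph D" using assms(1) by (simp add: maximal_plane_graph_def)
  then have "planar (add_edge (ugraph D) u v)"
    using assms(2-4) nadj assms(5-) by (rule planar_add_edge)
  with nadj show False
    using assms(1-4) by (simp add: maximal_plane_graph_def maximal_planar_def)
qed

section \<open>Faces as open path-connected sets\<close>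

lemma closed_plane_support:
  assumes "plane_graph D"
  shows "closed (plane_support D)"
proof -
  interpret pair_graph "ugraph D" by (rule plane_graph_pair_graph[OF assms])
  have "closed (curve D e)" if "e \<in> parcs (ugraph D)" for e
    using that plane_graph_arc[OF assms, of "fst e" "snd e"] closed_arc_image by (metis prod.collapse)
  then show ?thesis
    unfolding plane_support_def
    using pair_finite_verts pair_finite_arcs by (intro closed_Un closed_UN finite_imp_closed) auto
qed

lemma face_open: "plane_graph D \<Longrightarrow> f \<in> faces D \<Longrightarrow> open f"
  unfolding faces_def using closed_plane_support open_components by blast

lemma face_path_connected: "plane_graph D \<Longrightarrow> f \<in> faces D \<Longrightarrow> path_connected f"
  using face_open[of D f] in_components_connected[of f] connected_open_path_connected
  unfolding faces_def by blast

lemma face_Int_support: "f \<in> faces D \<Longrightarrow> f \<inter> plane_support D = {}"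
  unfolding faces_def using in_components_subset by blast

lemma connected_subset_face:
  assumes "f \<in> faces D" "Topological_Spaces.connected S" "S \<inter> plane_support D = {}" "S \<inter> f \<noteq> {}"
  shows "S \<subseteq> f"
  using assms components_maximal[of f "- plane_support D" S] unfolding faces_def by blast

section \<open>Vertices in a face of a plane subgraph\<close>

locale plane_subgraph_pair =
  fixes H G :: "'a plane_drawing"
  assumes plane_H: "plane_graph H" and plane_G: "plane_graph G"
    and plane_sub: "plane_subgraph H G"
begin

lemma verts_sub: "pverts (ugraph H) \<subseteq> pverts (ugraph G)"
  and arcs_sub: "parcs (ugraph H) \<subseteq> parcs (ugraph G)"
  and point_eq: "v \<in> pverts (ugraph H) \<Longrightarrow> point H v = point G v"
  and curve_eq: "e \<in> parcs (ugraph H) \<Longrightarrow> curve H e = curve G e"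
  using plane_sub by (auto simp: plane_subgraph_def subgraph_def)

text \<open>A point on an edge of \<open>H\<close> is on an edge of \<open>G\<close>, and a vertex
  of \<open>G\<close> lies on such an edge only as one of its ends.\<close>

lemma vertex_on_support:
  assumes "y \<in> pverts (ugraph G)" "point G y \<in> plane_support H"
  shows "y \<in> pverts (ugraph H)"
proof -
  have inj: "inj_on (point G) (pverts (ugraph G))"
    using plane_G by (simp add: plane_graph_def)
  from assms(2) consider w where "w \<in> pverts (ugraph H)" "point G y = point H w"
    | a b where "(a, b) \<in> parcs (ugraph H)" "point G y \<in> curve H (a, b)"
    unfolding plane_support_def by fastforce
  then show ?thesis
  proof cases
    case 1
    then show ?thesis using inj verts_sub point_eq assms(1) by (auto dest: inj_onD)
  next
    case 2
    then have "y = a \<or> y = b"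
      using plane_graph_vertex_on_curve[OF plane_G] arcs_sub curve_eq assms(1) by blast
    then show ?thesis using 2 pair_graph_verts[OF plane_graph_pair_graph[OF plane_H]] by blast
  qed
qed

text \<open>All curves involved belong to the one drawing \<open>G\<close>, so its conditions on
  crossings apply.\<close>

lemma curve_Int_support:
  assumes yz: "(y, z) \<in> parcs (ugraph G)" "(y, z) \<notin> parcs (ugraph H)"
  shows "curve G (y, z) \<inter> plane_support H \<subseteq> point G ` ({y, z} \<inter> pverts (ugraph H))"
proof
  fix p assume p: "p \<in> curve G (y, z) \<inter> plane_support H"
  then consider w where "w \<in> pverts (ugraph H)" "p = point H w"
    | a b where "(a, b) \<in> parcs (ugraph H)" "p \<in> curve H (a, b)"
    unfolding plane_support_def by fastforce
  then show "p \<in> point G ` ({y, z} \<inter> pverts (ugraph H))"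
  proof cases
    case 1
    then have "w = y \<or> w = z"
      using plane_graph_vertex_on_curve[OF plane_G yz(1)] verts_sub point_eq p by auto
    with 1 show ?thesis using point_eq by auto
  next
    case 2
    \<comment> \<open>By symmetry of \<open>H\<close>, neither orientation of the edge is in
      \<open>H\<close>.\<close>
    have "{y, z} \<noteq> {a, b}"
      using 2(1) yz(2) pair_graph_sym[OF plane_graph_pair_graph[OF plane_H]]
      by (auto simp: doubleton_eq_iff dest: symD)
    then have "curve G (y, z) \<inter> curve G (a, b) \<subseteq> point G ` ({y, z} \<inter> {a, b})"
      using plane_graph_curves_Int[OF plane_G yz(1)] 2(1) arcs_sub by blast
    moreover have "p \<in> curve G (a, b)" using 2 curve_eq by auto
    ultimately have "p \<in> point G ` ({y, z} \<inter> {a, b})" using p by (meson IntD1 IntI subsetD)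
    moreover have "{a, b} \<subseteq> pverts (ugraph H)"
      using 2(1) pair_graph_verts[OF plane_graph_pair_graph[OF plane_H]] by blast
    ultimately show ?thesis using image_mono[of "{y, z} \<inter> {a, b}"] by (meson Int_mono subsetD subset_refl)
  qed
qed

text \<open>This is the set \<open>F\<close> of the overview, and \<open>contacts\<close> is
  \<open>B\<close>. Placement refers to \<open>G\<close>, as vertices inside a face are not in
  \<open>H\<close>.\<close>

definition inside :: "complex set \<Rightarrow> 'a set" where
  "inside f = {y \<in> pverts (ugraph G). point G y \<in> f}"

definition contacts :: "complex set \<Rightarrow> 'a set" where
  "contacts f = {z \<in> pverts (ugraph H). \<exists>y\<in>inside f. (y, z) \<in> parcs (ugraph G)}"

lemma inside_not_H:
  assumes "f \<in> faces H" "y \<in> inside f"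
  shows "y \<notin> pverts (ugraph H)"
proof
  assume "y \<in> pverts (ugraph H)"
  then have "point G y \<in> plane_support H"
    using point_eq by (auto simp: plane_support_def)
  then show False using assms face_Int_support by (auto simp: inside_def)
qed

lemma inside_face_exists:
  assumes "v \<in> pverts (ugraph G)" "v \<notin> pverts (ugraph H)"
  obtains f where "f \<in> faces H" "v \<in> inside f"
proof -
  have "point G v \<in> \<Union> (faces H)"
    using vertex_on_support assms unfolding faces_def Union_components[symmetric] by auto
  then obtain f where "f \<in> faces H" "point G v \<in> f" by blast
  with assms(1) show thesis by (intro that) (auto simp: inside_def)
qed

text \<open>Without its end at \<open>z\<close>, the curve is connected, avoids the drawing of
  \<open>H\<close> and starts in \<open>f\<close>, so it cannot leave \<open>f\<close>. The end
  itself is a limit of points of \<open>f\<close>.\<close>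

lemma curve_in_face:
  assumes f: "f \<in> faces H" and y: "y \<in> inside f" and yz: "(y, z) \<in> parcs (ugraph G)"
  shows "curve G (y, z) - {point G z} \<subseteq> f" "z \<notin> pverts (ugraph H) \<Longrightarrow> point G z \<in> f"
    "point G z \<in> closure f"
proof -
  obtain g where g: "arc g" "pathstart g = point G y" "pathfinish g = point G z"
      "path_image g = curve G (y, z)"
    using plane_graph_arc[OF plane_G yz] .
  have yH: "y \<notin> pverts (ugraph H)" using inside_not_H[OF f y] .
  then have "(y, z) \<notin> parcs (ugraph H)"
    using pair_graph_verts[OF plane_graph_pair_graph[OF plane_H]] by blast
  from curve_Int_support[OF yz this] yH
  have Int: "curve G (y, z) \<inter> plane_support H \<subseteq> point G ` ({z} \<inter> pverts (ugraph H))" by blast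
  have cont: "continuous_on {0..1} g" using g(1) by (simp add: arc_def path_def)
  have img: "g ` {0..<1} = curve G (y, z) - {point G z}"
  proof -
    have "{0..1} = insert 1 {0..<1::real}" by auto
    then have "path_image g = insert (g 1) (g ` {0..<1})"
      unfolding path_image_def by (metis image_insert)
    moreover have "g 1 \<notin> g ` {0..<1}"
    proof
      assume "g 1 \<in> g ` {0..<1}"
      then obtain t where "t \<in> {0..<1}" "g 1 = g t" by blast
      then show False using g(1) unfolding arc_def by (auto dest: inj_onD)
    qed
    ultimately show ?thesis using g by (auto simp: pathfinish_def)
  qed
  have gf: "g ` {0..<1} \<subseteq> f"
  proof (rule connected_subset_face[OF f])
    show "Topological_Spaces.connected (g ` {0..<1})"
      using cont by (intro connected_continuous_image) (auto intro: continuous_on_subset)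
    show "g ` {0..<1} \<inter> plane_support H = {}" using Int unfolding img by auto
    have "g 0 \<in> f" using g(2) y by (simp add: inside_def pathstart_def)
    then show "g ` {0..<1} \<inter> f \<noteq> {}" by fastforce
  qed
  then show "curve G (y, z) - {point G z} \<subseteq> f" by (simp add: img)
  have "point G y \<in> f" "point G y \<in> curve G (y, z)" "point G z \<in> curve G (y, z)"
    using y g pathstart_in_path_image[of g] pathfinish_in_path_image[of g]
    by (auto simp: inside_def)
  then show "point G z \<in> f" if "z \<notin> pverts (ugraph H)"
  proof -
    \<comment> \<open>With \<open>z\<close> outside \<open>H\<close> the whole closed curve avoids
      the drawing of \<open>H\<close>.\<close>
    have "curve G (y, z) \<subseteq> f"
    proof (rule connected_subset_face[OF f])
      show "Topological_Spaces.connected (curve G (y, z))"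
        using connected_arc_image[OF g(1)] g(4) by simp
    qed (use Int that \<open>point G y \<in> f\<close> \<open>point G y \<in> curve G (y, z)\<close> in auto)
    with \<open>point G z \<in> curve G (y, z)\<close> show ?thesis by blast
  qed
  have "g ` closure {0..<1} \<subseteq> closure f"
    using cont gf closure_subset[of f] by (intro image_closure_subset) auto
  from subsetD[OF this imageI[of 1]] show "point G z \<in> closure f"
    using g(3) by (simp add: pathfinish_def)
qed

lemma inside_leave:
  assumes "f \<in> faces H" "y \<in> inside f" "(y, z) \<in> parcs (ugraph G)"
  shows "z \<in> inside f \<or> z \<in> contacts f"
  using curve_in_face(2)[OF assms] assms pair_graph_verts[OF plane_graph_pair_graph[OF plane_G] assms(3)]
  by (auto simp: inside_def contacts_def)

text \<open>A contact is a limit of points of \<open>f\<close> along an edge, but lies on the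
  drawing of \<open>H\<close> and hence outside the open set \<open>f\<close>.\<close>

lemma contacts_boundary:
  assumes "f \<in> faces H"
  shows "contacts f \<subseteq> boundary_verts H f"
proof
  fix z assume "z \<in> contacts f"
  then obtain y where z: "z \<in> pverts (ugraph H)" and y: "y \<in> inside f" "(y, z) \<in> parcs (ugraph G)"
    by (auto simp: contacts_def)
  have "point H z \<in> plane_support H" using z by (auto simp: plane_support_def)
  then have "point H z \<notin> f" using face_Int_support[OF assms] by blast
  moreover have "point H z \<in> closure f" using curve_in_face(3)[OF assms y] point_eq[OF z] by simp
  ultimately show "z \<in> boundary_verts H f"
    using z face_open[OF plane_H assms] by (simp add: boundary_verts_def frontier_def interior_open)
qed

lemma contacts_joined_through_face:
  assumes f: "f \<in> faces H" and bc: "b \<in> contacts f" "c \<in> contacts f" "b \<noteq> c"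
  obtains g where "arc g" "pathstart g = point H b" "pathfinish g = point H c"
    "path_image g \<inter> plane_support H \<subseteq> {point H b, point H c}"
proof -
  \<comment> \<open>A path inside \<open>S\<close> can meet the drawing of \<open>H\<close> only in
    the two contacts. It is composed of an edge from \<open>b\<close> into \<open>f\<close>, a path
    through \<open>f\<close> and an edge from \<open>f\<close> to \<open>c\<close>.\<close>
  define S where "S = insert (point H b) (insert (point H c) f)"
  have reach: "\<exists>y\<in>inside f. path_component S (point G y) (point H z)"
    if z: "z \<in> contacts f" "point H z \<in> S" for z
  proof -
    from z obtain y where zH: "z \<in> pverts (ugraph H)" and y: "y \<in> inside f" "(y, z) \<in> parcs (ugraph G)"
      by (auto simp: contacts_def)
    obtain h where h: "arc h" "pathstart h = point G y" "pathfinish h = point G z"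
        "path_image h = curve G (y, z)"
      using plane_graph_arc[OF plane_G y(2)] .
    have "path_image h \<subseteq> S"
      using curve_in_face(1)[OF f y] z(2) point_eq[OF zH] h(4) by (auto simp: S_def)
    then show ?thesis
      using h y(1) point_eq[OF zH] unfolding path_component_def by (metis arc_imp_path)
  qed
  obtain y where y: "y \<in> inside f" "path_component S (point G y) (point H b)"
    using reach[OF bc(1)] by (auto simp: S_def)
  obtain z where z: "z \<in> inside f" "path_component S (point G z) (point H c)"
    using reach[OF bc(2)] by (auto simp: S_def)
  have "path_component f (point G y) (point G z)"
    using face_path_connected[OF plane_H f] y(1) z(1)
    by (auto simp: path_connected_component inside_def)
  then have "path_component S (point G y) (point G z)"
    by (rule path_component_of_subset[rotated]) (auto simp: S_def)
  then have "path_component S (point H b) (point H c)"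
    using y(2) z(2) by (meson path_component_sym path_component_trans)
  then obtain p where p: "path p" "path_image p \<subseteq> S" "pathstart p = point H b" "pathfinish p = point H c"
    unfolding path_component_def by blast
  \<comment> \<open>The composed path may cross itself; as its ends differ, it contains an arc
    between them.\<close>
  have "point H b \<noteq> point H c"
    using bc plane_H by (auto simp: contacts_def plane_graph_def dest: inj_onD)
  then obtain g where "arc g" "path_image g \<subseteq> path_image p" "pathstart g = point H b"
      "pathfinish g = point H c"
    using path_contains_arc p by metis
  moreover have "S \<inter> plane_support H \<subseteq> {point H b, point H c}"
    using face_Int_support[OF f] by (auto simp: S_def)
  ultimately show thesis using that p(2) by blast
qed

lemma maximal_contacts_clique:
  assumes "maximal_plane_graph H" "f \<in> faces H" "b \<in> contacts f" "c \<in> contacts f" "b \<noteq> c"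
  shows "(b, c) \<in> parcs (ugraph H)"
proof -
  obtain g where "arc g" "pathstart g = point H b" "pathfinish g = point H c"
    "path_image g \<inter> plane_support H \<subseteq> {point H b, point H c}"
    using contacts_joined_through_face[OF assms(2-)] .
  then show ?thesis
    using maximal_plane_graph_adjacent[OF assms(1)] assms(3-) by (auto simp: contacts_def)
qed

text \<open>An edge of \<open>G\<close> missing from \<open>H\<close> would be an arc along which
  \<open>H\<close> could be extended. Thus non-adjacency in \<open>H\<close>, which is what a
  non-dominating face provides, carries over to \<open>G\<close>.\<close>

lemma maximal_induced:
  assumes "maximal_plane_graph H" "b \<in> pverts (ugraph H)" "c \<in> pverts (ugraph H)"
    "(b, c) \<in> parcs (ugraph G)"
  shows "(b, c) \<in> parcs (ugraph H)"
proof (rule ccontr)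
  assume nadj: "(b, c) \<notin> parcs (ugraph H)"
  obtain g where g: "arc g" "pathstart g = point G b" "pathfinish g = point G c"
      "path_image g = curve G (b, c)"
    using plane_graph_arc[OF plane_G assms(4)] .
  have "path_image g \<inter> plane_support H \<subseteq> {point H b, point H c}"
    using curve_Int_support[OF assms(4) nadj] g(4) point_eq assms(2,3) by auto
  then show False
    using maximal_plane_graph_adjacent[OF assms(1-3), of g] nadj g point_eq assms(2,3)
      pair_graph_verts[OF plane_graph_pair_graph[OF plane_G] assms(4)] by auto
qed

end

section \<open>Comparison of eccentricities in the connected graph \<open>G\<close>\<close>

lemma connected_pair_graph_rtrancl:
  assumes "pair_graph G" "Digraph_Component.connected (with_proj G)"
    "u \<in> pverts G" "v \<in> pverts G"
  shows "(u, v) \<in> (parcs G)\<^sup>*"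
proof -
  interpret pair_graph G by fact
  have "u \<rightarrow>\<^sup>*\<^bsub>with_proj G\<^esub> v"
    using symmetric_connected_imp_strongly_connected[OF pair_sym_arcs assms(2)] assms(3,4)
    by (auto simp: strongly_connected_def)
  then show ?thesis unfolding reachable_def by (simp add: rtrancl_on_rtranclI)
qed

theorem theorem31:
  fixes H G :: "'a plane_drawing"
  assumes "maximal_plane_graph H"
    and "\<not> (\<exists>f. dominating_face H f)"
    and "plane_graph G"
    and "Digraph_Component.connected (with_proj (ugraph G))"
    and "plane_subgraph H G"
    and "equi_eccentric (ugraph H) (ugraph G)"
  shows "subgraph (with_proj (ugraph H)) (graph_center (ugraph G))"
proof -
  interpret plane_subgraph_pair H G
    using assms by unfold_locales (auto simp: maximal_plane_graph_def)
  interpret G: pair_graph "ugraph G" by (rule plane_graph_pair_graph[OF plane_G])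
  note pg_H = plane_graph_pair_graph[OF plane_H]
  define V where "V = pverts (ugraph G)"
  define E where "E = parcs (ugraph G)"
  have finV: "finite V" unfolding V_def by (rule G.pair_finite_verts)
  \<comment> \<open>Connectedness makes all distances finite, so they are lengths of actual walks
    and eccentricities are natural numbers.\<close>
  have dist: "\<exists>n. graph_dist (ugraph G) u x = ereal (real n) \<and> (u, x) \<in> E ^^ n"
    if "u \<in> V" "x \<in> V" for u x
    using graph_dist_attained[OF G.pair_wf_digraph, of u x] that
      connected_pair_graph_rtrancl[OF G.pair_graph assms(4), of u x]
    unfolding V_def E_def by metis
  have ecc_ge: "graph_dist (ugraph G) u x \<le> eccentricity (ugraph G) u" if "x \<in> V" for u x
    unfolding eccentricity_def using finV that by (auto simp: V_def)
  have ecc_attained: "\<exists>x\<in>V. eccentricity (ugraph G) u = graph_dist (ugraph G) u x" if "u \<in> V" for u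
  proof -
    have "eccentricity (ugraph G) u \<in> graph_dist (ugraph G) u ` V"
      unfolding eccentricity_def V_def[symmetric] using finV that by (intro Max_in) auto
    then show ?thesis by blast
  qed
  have HV: "u \<in> V" if "u \<in> pverts (ugraph H)" for u
    using that verts_sub by (auto simp: V_def)
  have central: "eccentricity (ugraph G) u \<le> eccentricity (ugraph G) v"
    if u: "u \<in> pverts (ugraph H)" and v: "v \<in> V" for u v
  proof (rule ccontr)
    assume less: "\<not> eccentricity (ugraph G) u \<le> eccentricity (ugraph G) v"
    obtain r where r: "eccentricity (ugraph G) u = ereal (real r)"
      using ecc_attained[OF HV[OF u]] dist HV[OF u] by metis
    have ecc_H: "eccentricity (ugraph G) b = ereal (real r)" if "b \<in> pverts (ugraph H)" for b
      using assms(6) that u r by (metis equi_eccentric_def)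
    have "v \<notin> pverts (ugraph H)" using ecc_H less r by auto
    then obtain f where f: "f \<in> faces H" and vf: "v \<in> inside f"
      using inside_face_exists v unfolding V_def by blast
    \<comment> \<open>The face containing \<open>v\<close> is not dominating; \<open>w\<close>
      witnesses this.\<close>
    obtain w where w: "w \<in> pverts (ugraph H)" "w \<notin> boundary_verts H f"
        "\<And>b. b \<in> boundary_verts H f \<Longrightarrow> (w, b) \<notin> parcs (ugraph H)"
      using assms(2) f unfolding dominating_face_def by blast
    have contacts_H: "contacts f \<subseteq> pverts (ugraph H)" by (auto simp: contacts_def)
    show False
    proof (rule clique_separator_eccentricity[of E "inside f" "contacts f" w V v r])
      show "sym E" unfolding E_def by (rule pair_graph_sym[OF G.pair_graph])
      show "z \<in> inside f \<or> z \<in> contacts f" if "y \<in> inside f" "(y, z) \<in> E" for y z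
        using inside_leave[OF f] that by (simp add: E_def)
      show "b = c \<or> (b, c) \<in> E" if "b \<in> contacts f" "c \<in> contacts f" for b c
        using maximal_contacts_clique[OF assms(1) f that] arcs_sub by (auto simp: E_def)
      show "w \<in> V" using HV w(1) .
      show "w \<notin> inside f" using inside_not_H[OF f] w(1) by blast
      show "w \<notin> contacts f" using contacts_boundary[OF f] w(2) by blast
      show "(w, b) \<notin> E" if "b \<in> contacts f" for b
        using maximal_induced[OF assms(1) w(1)] w(3) contacts_boundary[OF f] contacts_H that
        unfolding E_def by blast
      show "v \<in> inside f" by (rule vf)
      show "\<exists>m<r. (v, x) \<in> E ^^ m" if "x \<in> V" for x
      proof -
        obtain m where m: "graph_dist (ugraph G) v x = ereal (real m)" "(v, x) \<in> E ^^ m"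
          using dist[OF v \<open>x \<in> V\<close>] by blast
        have "ereal (real m) < ereal (real r)"
          using ecc_ge[OF that, of v] less r m(1) by (metis leD leI order_le_less_trans)
        with m(2) show ?thesis by auto
      qed
      show "\<exists>x\<in>V. \<forall>m. (b, x) \<in> E ^^ m \<longrightarrow> r \<le> m" if "b \<in> contacts f" for b
      proof -
        have b: "b \<in> pverts (ugraph H)" using that contacts_H by blast
        obtain x where x: "x \<in> V" "graph_dist (ugraph G) b x = ereal (real r)"
          using ecc_attained[OF HV[OF b]] ecc_H[OF b] by metis
        have "r \<le> m" if "(b, x) \<in> E ^^ m" for m
          using graph_dist_le[OF G.pair_wf_digraph, of b x m] HV[OF b] that x(2)
          by (simp add: E_def V_def)
        with x(1) show ?thesis by blast
      qed
      show "\<exists>m\<le>r. (w, x) \<in> E ^^ m" if "x \<in> V" for x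
        using dist[OF HV[OF w(1)] that] ecc_ge[OF that, of w] ecc_H[OF w(1)] by auto
    qed
  qed
  have "wf_digraph (with_proj (ugraph H))"
    using assms(6) by (simp add: equi_eccentric_def subgraph_def)
  moreover have "wf_digraph (graph_center (ugraph G))"
    unfolding graph_center_def by (rule G.wellformed_induce_subgraph)
  \<comment> \<open>The center is an induced subgraph, so once the vertices of \<open>H\<close> are
    central its arcs lie in the center too.\<close>
  ultimately show ?thesis
    using HV central arcs_sub pair_graph_verts[OF pg_H]
    by (auto simp: subgraph_def compatible_def graph_center_def V_def)
qed

end
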